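(* Every non-pathological ideal on $\omega$ is contained in some density ideal on $\omega$.
   Context: An ideal on $\omega$ is a family $I\subseteq\wp(\omega)$ such that $\{A\subseteq\omega:\omega\setminus A\in I\}$ is a proper filter (in particular $\omega\notin I$). A submeasure on $\omega$ is $\varphi:\wp(\omega)\to[0,+\infty]$ with $\varphi(\emptyset)=0$, $\varphi(\{n\})<\infty$ for all $n$, and $\varphi(A)\le\varphi(A\cup B)\le\varphi(A)+\varphi(B)$. It is lower semi-continuous (lsc) if $\varphi(A)=\lim_{n\to\infty}\varphi(A\cap[0,n])$ for all $A$. For lsc $\varphi$, $\operatorname{Exh}(\varphi)=\{A\subseteq\omega:\lim_{n\to\infty}\varphi(A\setminus[0,n])=0\}$. $\varphi$ is non-pathological if for every $A\subseteq\omega$, $\varphi(A)=\sup\{\mu(A):\mu$ is a non-negative ($\sigma$-additive, finite) measure on $\wp(\omega)$ with $\mu(B)\le\varphi(B)$ for all $B\subseteq\omega\}$. An ideal $I$ on $\omega$ is non-pathological if $I=\operatorname{Exh}(\varphi)$ for some non-pathological lsc submeasure $\varphi$. A density submeasure is a submeasure of the form $\varphi=\sup_{n\in\omega}\mu_n$ for some sequence $\langle\mu_n\rangle$ of finitely supported non-negative measures on $\omega$ with pairwise disjoint supports; an ideal $I$ is a density ideal if $I=\operatorname{Exh}(\varphi)$ for some density submeasure $\varphi$. *)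

theory Defs
  imports "HOL-Analysis.Analysis"
begin

text \<open>The set of natural numbers plays the role of \<open>\<omega>\<close>.  The proper filter below ranges over
  the library type of filters, whose only improper element is \<open>bot\<close>.\<close>

definition ideal_on_omega :: "nat set set \<Rightarrow> bool" where
  "ideal_on_omega I \<longleftrightarrow>
     (\<exists>F :: nat filter. F \<noteq> bot \<and> {A. UNIV - A \<in> I} = {A. eventually (\<lambda>n. n \<in> A) F})"

definition submeasure :: "(nat set \<Rightarrow> ennreal) \<Rightarrow> bool" where
  "submeasure \<phi> \<longleftrightarrow>
     \<phi> {} = 0 \<and> (\<forall>n. \<phi> {n} < \<infinity>) \<and>
     (\<forall>A B. \<phi> A \<le> \<phi> (A \<union> B) \<and> \<phi> (A \<union> B) \<le> \<phi> A + \<phi> B)"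

definition lsc_submeasure :: "(nat set \<Rightarrow> ennreal) \<Rightarrow> bool" where
  "lsc_submeasure \<phi> \<longleftrightarrow>
     submeasure \<phi> \<and> (\<forall>A. (\<lambda>n. \<phi> (A \<inter> {0..n})) \<longlonglongrightarrow> \<phi> A)"

definition Exh :: "(nat set \<Rightarrow> ennreal) \<Rightarrow> nat set set" where
  "Exh \<phi> = {A. (\<lambda>n. \<phi> (A - {0..n})) \<longlonglongrightarrow> 0}"

definition finite_measure_on_omega :: "nat measure \<Rightarrow> bool" where
  "finite_measure_on_omega M \<longleftrightarrow> sets M = Pow UNIV \<and> finite_measure M"

definition non_pathological :: "(nat set \<Rightarrow> ennreal) \<Rightarrow> bool" where
  "non_pathological \<phi> \<longleftrightarrow>
     (\<forall>A. \<phi> A = (SUP M \<in> {M. finite_measure_on_omega M \<and> (\<forall>B. emeasure M B \<le> \<phi> B)}.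
                   emeasure M A))"

definition non_pathological_ideal :: "nat set set \<Rightarrow> bool" where
  "non_pathological_ideal I \<longleftrightarrow>
     ideal_on_omega I \<and> (\<exists>\<phi>. lsc_submeasure \<phi> \<and> non_pathological \<phi> \<and> I = Exh \<phi>)"

text \<open>Since all subsets of \<open>\<omega>\<close> are measurable and \<open>\<omega>\<close> is countable, a measure is concentrated
  on its set of atoms, so the latter is its support.\<close>

definition measure_support :: "nat measure \<Rightarrow> nat set" where
  "measure_support M = {n. emeasure M {n} \<noteq> 0}"

definition density_submeasure :: "(nat set \<Rightarrow> ennreal) \<Rightarrow> bool" where
  "density_submeasure \<phi> \<longleftrightarrow>
     submeasure \<phi> \<and>
     (\<exists>\<mu> :: nat \<Rightarrow> nat measure.
        (\<forall>n. finite_measure_on_omega (\<mu> n) \<and> finite (measure_support (\<mu> n))) \<and>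
        disjoint_family (\<lambda>n. measure_support (\<mu> n)) \<and>
        (\<forall>A. \<phi> A = (SUP n. emeasure (\<mu> n) A)))"

definition density_ideal :: "nat set set \<Rightarrow> bool" where
  "density_ideal I \<longleftrightarrow>
     ideal_on_omega I \<and> (\<exists>\<phi>. density_submeasure \<phi> \<and> I = Exh \<phi>)"

end

theory Submission imports Defs begin

text \<open>
  Let \<open>I = Exh \<phi>\<close>.  Since \<open>I\<close> is proper, the tails of \<open>\<omega>\<close> have \<open>\<phi>\<close>-value above some
  fixed \<open>\<epsilon> > 0\<close>.  By non-pathology, every tail carries a measure below \<open>\<phi>\<close> whose mass
  exceeds \<open>\<epsilon>\<close>, already on a finite interval.  Iterating gives consecutive intervals with
  such measures; the supremum \<open>\<psi>\<close> of their restrictions is a density submeasure with \<open>\<psi> \<le> \<phi>\<close>,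
  so \<open>Exh \<phi> \<subseteq> Exh \<psi>\<close>, and \<open>Exh \<psi>\<close> is proper since each tail of \<open>\<omega>\<close> contains
  one of the intervals.
\<close>

lemma submeasure_mono:
  assumes "submeasure \<phi>" and "A \<subseteq> B"
  shows "\<phi> A \<le> \<phi> B"
  using assms unfolding submeasure_def by (metis Un_absorb1)

lemma Exh_antimono:
  assumes "\<And>A. \<psi> A \<le> \<phi> A"
  shows "Exh \<phi> \<subseteq> Exh \<psi>"
proof
  fix A assume "A \<in> Exh \<phi>"
  then have "(\<lambda>n. \<phi> (A - {0..n})) \<longlonglongrightarrow> 0"
    by (simp add: Exh_def)
  then have "(\<lambda>n. \<psi> (A - {0..n})) \<longlonglongrightarrow> 0"
    by (rule tendsto_sandwich[OF _ _ tendsto_const, rotated 2]) (auto intro!: always_eventually assms)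
  then show "A \<in> Exh \<psi>"
    by (simp add: Exh_def)
qed

text \<open>The values on the tails decrease by monotonicity, so they fail to tend to 0 exactly when
  they stay above a positive bound.\<close>

lemma UNIV_notin_Exh_iff:
  assumes "submeasure \<phi>"
  shows "UNIV \<notin> Exh \<phi> \<longleftrightarrow> (\<exists>\<epsilon>>0. \<forall>n. \<epsilon> < \<phi> {n<..})"
proof -
  have tail: "UNIV - {0..n} = {n<..}" for n :: nat
    by auto
  show ?thesis
  proof
    assume notin: "UNIV \<notin> Exh \<phi>"
    show "\<exists>\<epsilon>>0. \<forall>n. \<epsilon> < \<phi> {n<..}"
    proof (rule ccontr)
      assume no_bound: "\<not> ?thesis"
      have "\<forall>\<^sub>F n in sequentially. \<phi> {n<..} < a" if "0 < a" for a
      proof -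
        \<comment> \<open>\<open>no_bound\<close> yields only a weak inequality for some tail, while
          the limit criterion needs a strict one; an intermediate \<open>b\<close> bridges the
          gap.\<close>
        obtain b where "0 < b" "b < a"
          using \<open>0 < a\<close> dense by blast
        with no_bound obtain n where n: "\<phi> {n<..} \<le> b"
          by (meson not_less)
        have "\<phi> {m<..} < a" if "n \<le> m" for m
        proof -
          have "\<phi> {m<..} \<le> \<phi> {n<..}"
            using that by (intro submeasure_mono[OF assms]) auto
          with n \<open>b < a\<close> show ?thesis by simp
        qed
        then show ?thesis
          by (auto simp: eventually_sequentially)
      qed
      then have "(\<lambda>n. \<phi> {n<..}) \<longlonglongrightarrow> 0"
        by (intro order_tendstoI) auto
      with notin show False
        by (simp add: Exh_def tail)
    qed
  next
    assume "\<exists>\<epsilon>>0. \<forall>n. \<epsilon> < \<phi> {n<..}"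
    then obtain \<epsilon> where "\<epsilon> > 0" and \<epsilon>: "\<And>n. \<epsilon> < \<phi> {n<..}"
      by blast
    show "UNIV \<notin> Exh \<phi>"
    proof
      assume "UNIV \<in> Exh \<phi>"
      then have "(\<lambda>n. \<phi> {n<..}) \<longlonglongrightarrow> 0"
        by (simp add: Exh_def tail)
      then have "\<epsilon> \<le> 0"
        by (rule LIMSEQ_le_const) (use \<epsilon> less_imp_le in blast)
      with \<open>\<epsilon> > 0\<close> show False by simp
    qed
  qed
qed

lemma UNIV_notin_ideal_on_omega:
  assumes "ideal_on_omega I"
  shows "UNIV \<notin> I"
proof
  assume "UNIV \<in> I"
  obtain F :: "nat filter" where "F \<noteq> bot"
    and F: "{A. UNIV - A \<in> I} = {A. eventually (\<lambda>n. n \<in> A) F}"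
    using assms unfolding ideal_on_omega_def by blast
  have "{} \<in> {A. UNIV - A \<in> I}"
    using \<open>UNIV \<in> I\<close> by simp
  then have "eventually (\<lambda>n. n \<in> {}) F"
    unfolding F by simp
  with \<open>F \<noteq> bot\<close> show False by simp
qed

text \<open>Monotonicity makes \<open>Exh \<phi>\<close> closed under subsets, subadditivity under
  finite unions; these are the filter axioms for the complements.\<close>

lemma ideal_on_omega_Exh:
  assumes "submeasure \<phi>" and "UNIV \<notin> Exh \<phi>"
  shows "ideal_on_omega (Exh \<phi>)"
proof -
  have empty: "{} \<in> Exh \<phi>"
    using assms(1) by (simp add: Exh_def submeasure_def)
  have subset: "A \<in> Exh \<phi>" if "B \<in> Exh \<phi>" "A \<subseteq> B" for A B
  proof -
    have "(\<lambda>n. \<phi> (B - {0..n})) \<longlonglongrightarrow> 0"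
      using that by (simp add: Exh_def)
    then have "(\<lambda>n. \<phi> (A - {0..n})) \<longlonglongrightarrow> 0"
      by (rule tendsto_sandwich[OF _ _ tendsto_const, rotated 2])
        (use that in \<open>auto intro!: always_eventually submeasure_mono[OF assms(1)]\<close>)
    then show ?thesis by (simp add: Exh_def)
  qed
  have union: "A \<union> B \<in> Exh \<phi>" if "A \<in> Exh \<phi>" "B \<in> Exh \<phi>" for A B
  proof -
    have "(\<lambda>n. \<phi> (A - {0..n}) + \<phi> (B - {0..n})) \<longlonglongrightarrow> 0 + 0"
      using that by (intro tendsto_add) (auto simp: Exh_def)
    then have "(\<lambda>n. \<phi> (A - {0..n}) + \<phi> (B - {0..n})) \<longlonglongrightarrow> 0"
      by simp
    then have "(\<lambda>n. \<phi> (A \<union> B - {0..n})) \<longlonglongrightarrow> 0"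
      by (rule tendsto_sandwich[OF _ _ tendsto_const, rotated 2])
        (use assms(1) in \<open>auto simp: Un_Diff submeasure_def\<close>)
    then show ?thesis by (simp add: Exh_def)
  qed
  \<comment> \<open>The dual filter: a predicate holds eventually when its exceptional set lies in
    \<open>Exh \<phi>\<close>.\<close>
  define F where "F = Abs_filter (\<lambda>P. {n. \<not> P n} \<in> Exh \<phi>)"
  have "is_filter (\<lambda>P. {n. \<not> P n} \<in> Exh \<phi>)"
  proof
    show "{n. \<not> True} \<in> Exh \<phi>"
      using empty by simp
  next
    fix P Q assume "{n. \<not> P n} \<in> Exh \<phi>" "{n. \<not> Q n} \<in> Exh \<phi>"
    then have "{n. \<not> P n} \<union> {n. \<not> Q n} \<in> Exh \<phi>"
      by (rule union)
    then show "{n. \<not> (P n \<and> Q n)} \<in> Exh \<phi>"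
      by (rule subset) auto
  next
    fix P Q assume "\<forall>n. P n \<longrightarrow> Q n" "{n. \<not> P n} \<in> Exh \<phi>"
    then show "{n. \<not> Q n} \<in> Exh \<phi>"
      by (auto intro: subset)
  qed
  then have F: "eventually P F \<longleftrightarrow> {n. \<not> P n} \<in> Exh \<phi>" for P
    unfolding F_def by (rule eventually_Abs_filter)
  have "F \<noteq> bot"
    using assms(2) F[of "\<lambda>_. False"] by auto
  moreover have "UNIV - A = {n. n \<notin> A}" for A :: "nat set"
    by auto
  ultimately show ?thesis
    unfolding ideal_on_omega_def by (intro exI[of _ F]) (simp add: F)
qed

text \<open>Monotonicity and subadditivity pass from measures to their supremum. Finiteness on
  singletons need not, hence the second assumption.\<close>

lemma submeasure_SUP_emeasure:
  assumes "\<And>n. sets (\<mu> n) = Pow UNIV"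
    and "\<And>k. (SUP n. emeasure (\<mu> n) {k}) < \<infinity>"
  shows "submeasure (\<lambda>A. SUP n. emeasure (\<mu> n) A)"
  unfolding submeasure_def
proof (intro conjI allI)
  fix A B
  show "(SUP n. emeasure (\<mu> n) A) \<le> (SUP n. emeasure (\<mu> n) (A \<union> B))"
    by (intro SUP_mono' emeasure_mono) (auto simp: assms)
  show "(SUP n. emeasure (\<mu> n) (A \<union> B)) \<le> (SUP n. emeasure (\<mu> n) A) + (SUP n. emeasure (\<mu> n) B)"
  proof (rule SUP_least)
    fix n
    have "emeasure (\<mu> n) (A \<union> B) \<le> emeasure (\<mu> n) A + emeasure (\<mu> n) B"
      by (intro emeasure_subadditive) (auto simp: assms)
    also have "\<dots> \<le> (SUP n. emeasure (\<mu> n) A) + (SUP n. emeasure (\<mu> n) B)"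
      by (intro add_mono SUP_upper) auto
    finally show "emeasure (\<mu> n) (A \<union> B) \<le> \<dots>" .
  qed
qed (use assms in auto)

text \<open>A strict lower bound for a supremum is exceeded by a single measure, and continuity from
  below then cuts the tail down to a finite interval.\<close>

lemma non_pathological_interval:
  assumes "non_pathological \<phi>" and "\<epsilon> < \<phi> {m<..}"
  shows "\<exists>M n. finite_measure_on_omega M \<and> (\<forall>B. emeasure M B \<le> \<phi> B) \<and>
               m < n \<and> \<epsilon> < emeasure M {m<..n}"
proof -
  have "\<epsilon> < (SUP M \<in> {M. finite_measure_on_omega M \<and> (\<forall>B. emeasure M B \<le> \<phi> B)}.
                emeasure M {m<..})"
    using assms unfolding non_pathological_def by metis
  then obtain M where M: "finite_measure_on_omega M" "\<forall>B. emeasure M B \<le> \<phi> B"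
    and big: "\<epsilon> < emeasure M {m<..}"
    by (auto simp: less_SUP_iff)
  have "(SUP n. emeasure M {m<..n}) = emeasure M (\<Union>n. {m<..n})"
    using M(1) by (intro SUP_emeasure_incseq) (auto simp: finite_measure_on_omega_def incseq_def)
  also have "(\<Union>n. {m<..n}) = {m<..}"
    by auto
  finally obtain n where n: "\<epsilon> < emeasure M {m<..n}"
    using big by (metis UNIV_I less_SUP_iff)
  \<comment> \<open>Otherwise the interval is empty and has measure 0, which cannot exceed
    \<open>\<epsilon>\<close>.\<close>
  then have "m < n"
    by (metis emeasure_empty greaterThanAtMost_empty not_less not_less_zero)
  with M n show ?thesis by blast
qed

theorem corollary6p4:
  fixes I :: "nat set set"
  assumes "non_pathological_ideal I"
  shows "\<exists>J. density_ideal J \<and> I \<subseteq> J"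
proof -
  obtain \<phi> where sub: "submeasure \<phi>" and np: "non_pathological \<phi>" and I: "I = Exh \<phi>"
    and "UNIV \<notin> I"
    using assms UNIV_notin_ideal_on_omega
    unfolding non_pathological_ideal_def lsc_submeasure_def by blast
  then obtain \<epsilon> where "\<epsilon> > 0" and \<epsilon>: "\<And>n. \<epsilon> < \<phi> {n<..}"
    using UNIV_notin_Exh_iff by blast
  obtain M g where M: "\<And>m. finite_measure_on_omega (M m)" "\<And>m B. emeasure (M m) B \<le> \<phi> B"
    and g: "\<And>m. m < g m" "\<And>m. \<epsilon> < emeasure (M m) {m<..g m}"
    using non_pathological_interval[OF np \<epsilon>] by metis
  \<comment> \<open>The right end chosen for one block is the left end of the next, so the ends are
    the iterates of \<open>g\<close>.\<close>
  define a where "a k = (g ^^ k) 0" for k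
  have a_Suc: "a (Suc k) = g (a k)" for k
    by (simp add: a_def)
  then have "strict_mono a"
    by (simp add: strict_mono_Suc_iff g)
  \<comment> \<open>An indicator density cuts \<open>M (a k)\<close> down to its block while keeping
    all subsets of \<open>UNIV\<close> measurable, as \<open>finite_measure_on_omega\<close>
    demands.\<close>
  define \<mu> where "\<mu> k = density (M (a k)) (indicator {a k<..a (Suc k)})" for k
  define \<psi> where "\<psi> A = (SUP k. emeasure (\<mu> k) A)" for A
  have sets_M: "sets (M m) = Pow UNIV" for m
    using M(1) by (simp add: finite_measure_on_omega_def)
  have sets_\<mu>: "sets (\<mu> k) = Pow UNIV" for k
    by (simp add: \<mu>_def sets_M)
  have \<mu>: "emeasure (\<mu> k) A = emeasure (M (a k)) ({a k<..a (Suc k)} \<inter> A)" for k A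
    unfolding \<mu>_def by (rule emeasure_restricted) (auto simp: sets_M)
  have \<mu>_le: "emeasure (\<mu> k) A \<le> \<phi> A" for k A
    unfolding \<mu> by (rule order_trans[OF M(2)]) (rule submeasure_mono[OF sub], simp)
  have \<psi>_le: "\<psi> A \<le> \<phi> A" for A
    unfolding \<psi>_def by (intro SUP_least \<mu>_le)
  have "\<psi> {k} < \<infinity>" for k
    using \<psi>_le[of "{k}"] sub le_less_trans unfolding submeasure_def by blast
  then have sub_\<psi>: "submeasure \<psi>"
    unfolding \<psi>_def by (intro submeasure_SUP_emeasure sets_\<mu>)
  have finite_\<mu>: "finite_measure_on_omega (\<mu> k)" for k
  proof -
    have "emeasure (\<mu> k) (space (\<mu> k)) \<noteq> \<infinity>"
      using M(1)[of "a k"] by (auto simp: \<mu> finite_measure_on_omega_def finite_measure.emeasure_finite)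
    then show ?thesis
      by (auto simp: finite_measure_on_omega_def sets_\<mu> intro: finite_measureI)
  qed
  have support: "measure_support (\<mu> k) \<subseteq> {a k<..a (Suc k)}" for k
  proof
    fix x assume "x \<in> measure_support (\<mu> k)"
    then have "emeasure (M (a k)) ({a k<..a (Suc k)} \<inter> {x}) \<noteq> 0"
      by (simp add: measure_support_def \<mu>)
    then have "{a k<..a (Suc k)} \<inter> {x} \<noteq> {}"
      by (metis emeasure_empty)
    then show "x \<in> {a k<..a (Suc k)}"
      by blast
  qed
  have "disjoint_family (\<lambda>k. {a k<..a (Suc k)})"
    unfolding disjoint_family_on_def
  proof (intro ballI impI)
    fix i j :: nat assume "i \<noteq> j"
    \<comment> \<open>The block of smaller index ends no later than the other begins; being open on
      the left, the blocks do not share that endpoint.\<close>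
    then have "a (Suc i) \<le> a j \<or> a (Suc j) \<le> a i"
      using strict_mono_less_eq[OF \<open>strict_mono a\<close>] by auto
    then show "{a i<..a (Suc i)} \<inter> {a j<..a (Suc j)} = {}"
      by auto
  qed
  then have disjoint: "disjoint_family (\<lambda>k. measure_support (\<mu> k))"
    using support by (rule disjoint_family_subset)
  have "density_submeasure \<psi>"
    unfolding density_submeasure_def
    using sub_\<psi> finite_\<mu> finite_subset[OF support] disjoint \<psi>_def by blast
  moreover have "\<epsilon> < \<psi> {n<..}" for n
  proof -
    \<comment> \<open>Block \<open>n\<close> starts at \<open>a n\<close>, hence lies wholly inside
      the tail beyond \<open>n\<close> and keeps its full mass there.\<close>
    have "n \<le> a n"
      using \<open>strict_mono a\<close> by (rule strict_mono_imp_increasing)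
    then have "{a n<..a (Suc n)} \<inter> {n<..} = {a n<..g (a n)}"
      by (auto simp: a_Suc)
    with g(2)[of "a n"] have "\<epsilon> < emeasure (\<mu> n) {n<..}"
      by (simp add: \<mu>)
    also have "\<dots> \<le> \<psi> {n<..}"
      unfolding \<psi>_def by (rule SUP_upper) simp
    finally show ?thesis .
  qed
  with \<open>\<epsilon> > 0\<close> have "UNIV \<notin> Exh \<psi>"
    using UNIV_notin_Exh_iff[OF sub_\<psi>] by blast
  ultimately have "density_ideal (Exh \<psi>)"
    using ideal_on_omega_Exh[OF sub_\<psi>] unfolding density_ideal_def by blast
  with Exh_antimono[of \<psi> \<phi>, OF \<psi>_le] I show ?thesis by blast
qed

end
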